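(* Let $\Delta^{(0)},\Delta^{(1)}$ be dynamic theories and $\mathcal A^{c}$ a set of heterogeneous atoms over them. Then the simple heterogeneous dynamic theory $\Delta^{sh}$ defined below is a dynamic theory; in particular rule (G) (if $\phi$ is valid then $[\alpha]\phi$ is valid) and the axioms (K) $[\alpha](\phi\to\psi)\to([\alpha]\phi\to[\alpha]\psi)$, (V) $\phi\to[\alpha]\phi$ when $\mathrm{FV}^{sem}(\phi)\cap\mathrm{BV}^{sem}(\alpha)=\emptyset$, and (B) $(\forall v[\alpha]\phi)\leftrightarrow([\alpha]\forall v\phi)$ when $v\notin\mathrm{FV}^{sem}(\alpha)\cup\mathrm{BV}^{sem}(\alpha)$ are sound for $\Delta^{sh}$.
   Context: A dynamic theory $\Delta$ consists of: pairwise disjoint sets $\mathcal V$ (variables), $\mathcal A$ (atoms), $\mathcal P$ (programs); a nonempty set $U$; a nonempty set $S$ of states with $\mathrm{val}:S\times\mathcal V\to U$ satisfying interpolation (for all $\mu,\nu\in S$, $W\subseteq\mathcal V$ there is $\omega\in S$ agreeing with $\mu$ on $W$ and with $\nu$ outside $W$); $\mathcal E_A:\mathcal A\to2^S$ and $\mathrm{FV}_A:\mathcal A\to 2^{\mathcal V}$ with $\mathrm{FV}_A(a)$ finite and states agreeing on $\mathrm{FV}_A(a)$ both in or both out of $\mathcal E_A(a)$; $\mathcal E_P:\mathcal P\to 2^{S\times S}$ and $\mathrm{FV}_P:\mathcal P\to2^{\mathcal V}$ with $\mathrm{FV}_P(p)$ finite, overapproximation (for all $W\supseteq\mathrm{FV}_P(p)$: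 if $\mu=_W\nu$ and $(\mu,\omega)\in\mathcal E_P(p)$ then some $\tilde\omega$ has $(\nu,\tilde\omega)\in\mathcal E_P(p)$, $\omega=_W\tilde\omega$) and extensionality (if $\mu=_{\mathcal V}\nu$ then $(\mu,\omega)\in\mathcal E_P(p)\iff(\nu,\omega)\in\mathcal E_P(p)$). $\mu=_W\nu$ means $\mathrm{val}(\mu,v)=\mathrm{val}(\nu,v)$ for all $v\in W$. Formulas, semantics ($[\![\forall vF]\!]=\{\mu:\forall\nu(\mu=_{\mathcal V\setminus\{v\}}\nu\Rightarrow\nu\in[\![F]\!])\}$, $[\![[p]F]\!]=\{\mu:\forall\nu((\mu,\nu)\in\mathcal E_P(p)\Rightarrow\nu\in[\![F]\!])\}$), validity, $\mathrm{FV}^{sem},\mathrm{BV}^{sem}$ as usual: $\mathrm{FV}^{sem}(F)=\{v:\exists\mu,\tilde\mu,\mu=_{\mathcal V\setminus\{v\}}\tilde\mu,\mu\in[\![F]\!]\not\ni\tilde\mu\}$, $\mathrm{FV}^{sem}(p)=\{v:\exists\mu,\tilde\mu,\nu$, $\mu=_{\mathcal V\setminus\{v\}}\tilde\mu$, $(\mu,\nu)\in\mathcal E_P(p)$, no $\tilde\nu$ with $\nu=_{\mathcal V\setminus\{v\}}\tilde\nu$, $(\tilde\mu,\tilde\nu)\in\mathcal E_P(p)\}$, $\mathrm{BV}^{sem}(p)=\{v:\exists(\mu,\tilde\mu)\in\mathcal E_P(p),\mathrm{val}(\mu,v)\neq\mathrm{val}(\tilde\mu,v)\}$. Given $\Delta^{(i)}$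 with components $\mathcal V^{(i)},\mathcal A^{(i)},\mathcal P^{(i)},U^{(i)},S^{(i)},\mathrm{val}^{(i)},\ldots$ ($i=0,1$; the variable, atom and program sets of the two theories are combined as disjoint unions): the heterogeneous state space is $S^{h}=S^{(0)}\times S^{(1)}$ with $\mathrm{val}^h((\mu_0,\mu_1),v)=\mathrm{val}^{(i)}(\mu_i,v)$ for $v\in\mathcal V^{(i)}$. A set of heterogeneous atoms is a set $\mathcal A^c$ with $\mathcal E^c_A:\mathcal A^c\to2^{S^h}$ and $\mathrm{FV}^c_A:\mathcal A^c\to2^{\mathcal V^{(0)}\cup\mathcal V^{(1)}}$ satisfying the atom requirements (finiteness and overapproximation) with respect to $S^h$. The simple heterogeneous theory $\Delta^{sh}$ has variables $\mathcal V^{(0)}\dot\cup\mathcal V^{(1)}$, atoms $\mathcal A^{(0)}\dot\cup\mathcal A^{(1)}\dot\cup\mathcal A^c$, programs $\mathcal P^{(0)}\dot\cup\mathcal P^{(1)}$, universe $U^{(0)}\cup U^{(1)}$, states $S^h$ with $\mathrm{val}^h$; atom evaluation $\mathcal E_A(a)=\mathcal E^{(0)}_A(a)\times S^{(1)}$ for $a\in\mathcal A^{(0)}$, $S^{(0)}\times\mathcal E^{(1)}_A(a)$ for $a\in\mathcal A^{(1)}$, $\mathcal E^c_A(a)$ for $a\in\mathcal A^c$, with $\mathrm{FV}_A$ taken from the respective component; program evaluation $\mathcal E_P(p)=\mathcal E^{(i)}_P(p)$ and $\mathrm{FV}_P(p)=\mathrm{FV}^{(i)}_P(p)$ for $p\in\mathcal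 P^{(i)}$, where a transition of $p\in\mathcal P^{(i)}$ acts on the $i$-th component of a state pair and leaves the other component unchanged.
   Formalization: A program's transition leaves the other state component unchanged only up to the values of all its variables, not as an identical state; with literal identity, extensionality fails when distinct states share all values. Both readings coincide when states are determined by their values. *)

theory Defs
  imports Main
begin

text \<open>
  Variables, atoms and programs live in three different types, so their pairwise disjointness
  holds by typing. Components are only meaningful on the carrier sets.
\<close>

record ('v, 'a, 'p, 'u, 's) dyn_theory =
  Vars :: "'v set"
  Atoms :: "'a set"
  Progs :: "'p set"
  Univ :: "'u set"
  States :: "'s set"
  Val :: "'s \<Rightarrow> 'v \<Rightarrow> 'u"
  EvalA :: "'a \<Rightarrow> 's set"
  FVA :: "'a \<Rightarrow> 'v set"
  EvalP :: "'p \<Rightarrow> ('s \<times> 's) set"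
  FVP :: "'p \<Rightarrow> 'v set"

definition agree_on :: "('s \<Rightarrow> 'v \<Rightarrow> 'u) \<Rightarrow> 'v set \<Rightarrow> 's \<Rightarrow> 's \<Rightarrow> bool" where
  "agree_on val W \<mu> \<nu> \<longleftrightarrow> (\<forall>v\<in>W. val \<mu> v = val \<nu> v)"

text \<open>The requirements on atoms are shared with heterogeneous atoms below.\<close>

definition atom_requirements ::
  "'v set \<Rightarrow> 's set \<Rightarrow> ('s \<Rightarrow> 'v \<Rightarrow> 'u) \<Rightarrow> 'a set \<Rightarrow> ('a \<Rightarrow> 's set) \<Rightarrow> ('a \<Rightarrow> 'v set) \<Rightarrow> bool" where
  "atom_requirements V S val A evalA fvA \<longleftrightarrow>
     (\<forall>a\<in>A. evalA a \<subseteq> S \<and> fvA a \<subseteq> V \<and> finite (fvA a) \<and>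
       (\<forall>\<mu>\<in>S. \<forall>\<nu>\<in>S. agree_on val (fvA a) \<mu> \<nu> \<longrightarrow> (\<mu> \<in> evalA a \<longleftrightarrow> \<nu> \<in> evalA a)))"

locale dynamic_theory =
  fixes D :: "('v, 'a, 'p, 'u, 's) dyn_theory"
  assumes univ_nonempty: "Univ D \<noteq> {}"
    and states_nonempty: "States D \<noteq> {}"
    and val_in_univ: "\<lbrakk>\<mu> \<in> States D; v \<in> Vars D\<rbrakk> \<Longrightarrow> Val D \<mu> v \<in> Univ D"
    and interpolation:
      "\<lbrakk>\<mu> \<in> States D; \<nu> \<in> States D; W \<subseteq> Vars D\<rbrakk> \<Longrightarrow>
       \<exists>\<omega>\<in>States D. agree_on (Val D) W \<omega> \<mu> \<and> agree_on (Val D) (Vars D - W) \<omega> \<nu>"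
    and atoms: "atom_requirements (Vars D) (States D) (Val D) (Atoms D) (EvalA D) (FVA D)"
    and evalP_subset: "p \<in> Progs D \<Longrightarrow> EvalP D p \<subseteq> States D \<times> States D"
    and FVP_subset: "p \<in> Progs D \<Longrightarrow> FVP D p \<subseteq> Vars D"
    and FVP_finite: "p \<in> Progs D \<Longrightarrow> finite (FVP D p)"
    and prog_overapproximation:
      "\<lbrakk>p \<in> Progs D; FVP D p \<subseteq> W; W \<subseteq> Vars D; \<mu> \<in> States D; \<nu> \<in> States D; \<omega> \<in> States D;
        agree_on (Val D) W \<mu> \<nu>; (\<mu>, \<omega>) \<in> EvalP D p\<rbrakk> \<Longrightarrow>
       \<exists>\<omega>'\<in>States D. (\<nu>, \<omega>') \<in> EvalP D p \<and> agree_on (Val D) W \<omega> \<omega>'"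
    and prog_extensionality:
      "\<lbrakk>p \<in> Progs D; \<mu> \<in> States D; \<nu> \<in> States D; \<omega> \<in> States D;
        agree_on (Val D) (Vars D) \<mu> \<nu>\<rbrakk> \<Longrightarrow>
       (\<mu>, \<omega>) \<in> EvalP D p \<longleftrightarrow> (\<nu>, \<omega>) \<in> EvalP D p"

datatype ('v, 'a, 'p) fml =
    Atom 'a
  | Neg "('v, 'a, 'p) fml"
  | Conj "('v, 'a, 'p) fml" "('v, 'a, 'p) fml"
  | Forall 'v "('v, 'a, 'p) fml"
  | Box 'p "('v, 'a, 'p) fml"

definition Imp :: "('v, 'a, 'p) fml \<Rightarrow> ('v, 'a, 'p) fml \<Rightarrow> ('v, 'a, 'p) fml" where
  "Imp F G = Neg (Conj F (Neg G))"

definition Iff :: "('v, 'a, 'p) fml \<Rightarrow> ('v, 'a, 'p) fml \<Rightarrow> ('v, 'a, 'p) fml" where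
  "Iff F G = Conj (Imp F G) (Imp G F)"

inductive_set formulas :: "('v, 'a, 'p, 'u, 's) dyn_theory \<Rightarrow> ('v, 'a, 'p) fml set"
  for D where
    "a \<in> Atoms D \<Longrightarrow> Atom a \<in> formulas D"
  | "F \<in> formulas D \<Longrightarrow> Neg F \<in> formulas D"
  | "\<lbrakk>F \<in> formulas D; G \<in> formulas D\<rbrakk> \<Longrightarrow> Conj F G \<in> formulas D"
  | "\<lbrakk>v \<in> Vars D; F \<in> formulas D\<rbrakk> \<Longrightarrow> Forall v F \<in> formulas D"
  | "\<lbrakk>p \<in> Progs D; F \<in> formulas D\<rbrakk> \<Longrightarrow> Box p F \<in> formulas D"

primrec sem :: "('v, 'a, 'p, 'u, 's) dyn_theory \<Rightarrow> ('v, 'a, 'p) fml \<Rightarrow> 's set" where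
  "sem D (Atom a) = EvalA D a"
| "sem D (Neg F) = States D - sem D F"
| "sem D (Conj F G) = sem D F \<inter> sem D G"
| "sem D (Forall v F) =
     {\<mu>\<in>States D. \<forall>\<nu>\<in>States D. agree_on (Val D) (Vars D - {v}) \<mu> \<nu> \<longrightarrow> \<nu> \<in> sem D F}"
| "sem D (Box p F) =
     {\<mu>\<in>States D. \<forall>\<nu>\<in>States D. (\<mu>, \<nu>) \<in> EvalP D p \<longrightarrow> \<nu> \<in> sem D F}"

definition valid :: "('v, 'a, 'p, 'u, 's) dyn_theory \<Rightarrow> ('v, 'a, 'p) fml \<Rightarrow> bool" where
  "valid D F \<longleftrightarrow> (\<forall>\<mu>\<in>States D. \<mu> \<in> sem D F)"

definition FVsem_fml :: "('v, 'a, 'p, 'u, 's) dyn_theory \<Rightarrow> ('v, 'a, 'p) fml \<Rightarrow> 'v set" where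
  "FVsem_fml D F =
     {v\<in>Vars D. \<exists>\<mu>\<in>States D. \<exists>\<mu>'\<in>States D.
        agree_on (Val D) (Vars D - {v}) \<mu> \<mu>' \<and> \<mu> \<in> sem D F \<and> \<mu>' \<notin> sem D F}"

definition FVsem_prog :: "('v, 'a, 'p, 'u, 's) dyn_theory \<Rightarrow> 'p \<Rightarrow> 'v set" where
  "FVsem_prog D p =
     {v\<in>Vars D. \<exists>\<mu>\<in>States D. \<exists>\<mu>'\<in>States D. \<exists>\<nu>\<in>States D.
        agree_on (Val D) (Vars D - {v}) \<mu> \<mu>' \<and> (\<mu>, \<nu>) \<in> EvalP D p \<and>
        \<not> (\<exists>\<nu>'\<in>States D. agree_on (Val D) (Vars D - {v}) \<nu> \<nu>' \<and> (\<mu>', \<nu>') \<in> EvalP D p)}"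

definition BVsem_prog :: "('v, 'a, 'p, 'u, 's) dyn_theory \<Rightarrow> 'p \<Rightarrow> 'v set" where
  "BVsem_prog D p =
     {v\<in>Vars D. \<exists>\<mu>\<in>States D. \<exists>\<mu>'\<in>States D. (\<mu>, \<mu>') \<in> EvalP D p \<and> Val D \<mu> v \<noteq> Val D \<mu>' v}"

text \<open>
  Disjoint unions are rendered by sum types. The universes share one type, since they are combined
  by an ordinary (not necessarily disjoint) union.
\<close>

definition het_vars ::
  "('v0, 'a0, 'p0, 'u, 's0) dyn_theory \<Rightarrow> ('v1, 'a1, 'p1, 'u, 's1) dyn_theory \<Rightarrow> ('v0 + 'v1) set" where
  "het_vars D0 D1 = Vars D0 <+> Vars D1"

definition het_states ::
  "('v0, 'a0, 'p0, 'u, 's0) dyn_theory \<Rightarrow> ('v1, 'a1, 'p1, 'u, 's1) dyn_theory \<Rightarrow> ('s0 \<times> 's1) set" where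
  "het_states D0 D1 = States D0 \<times> States D1"

definition het_val ::
  "('v0, 'a0, 'p0, 'u, 's0) dyn_theory \<Rightarrow> ('v1, 'a1, 'p1, 'u, 's1) dyn_theory \<Rightarrow>
     's0 \<times> 's1 \<Rightarrow> 'v0 + 'v1 \<Rightarrow> 'u" where
  "het_val D0 D1 \<mu> v = (case v of Inl x \<Rightarrow> Val D0 (fst \<mu>) x | Inr y \<Rightarrow> Val D1 (snd \<mu>) y)"

definition heterogeneous_atoms ::
  "('v0, 'a0, 'p0, 'u, 's0) dyn_theory \<Rightarrow> ('v1, 'a1, 'p1, 'u, 's1) dyn_theory \<Rightarrow>
     'c set \<Rightarrow> ('c \<Rightarrow> ('s0 \<times> 's1) set) \<Rightarrow> ('c \<Rightarrow> ('v0 + 'v1) set) \<Rightarrow> bool" where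
  "heterogeneous_atoms D0 D1 Ac evalAc fvAc \<longleftrightarrow>
     atom_requirements (het_vars D0 D1) (het_states D0 D1) (het_val D0 D1) Ac evalAc fvAc"

text \<open>
  A program of one theory leaves the state of the other theory unchanged in the sense that the
  value of every variable is preserved, i.e. up to the state equivalence \<open>=\<^sub>V\<close>. States need not be
  determined by their values, and with preservation of the state up to identity instead,
  extensionality of programs would fail for such state spaces. If states are determined by their
  values, the two readings coincide (lemmas \<open>het_evalP_Inl_identity\<close>, \<open>het_evalP_Inr_identity\<close>).
\<close>

definition het_evalP ::
  "('v0, 'a0, 'p0, 'u, 's0) dyn_theory \<Rightarrow> ('v1, 'a1, 'p1, 'u, 's1) dyn_theory \<Rightarrow>
     'p0 + 'p1 \<Rightarrow> (('s0 \<times> 's1) \<times> ('s0 \<times> 's1)) set" where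
  "het_evalP D0 D1 r =
     (case r of
        Inl p \<Rightarrow> {((\<mu>0, \<mu>1), (\<nu>0, \<nu>1)). (\<mu>0, \<nu>0) \<in> EvalP D0 p \<and>
                   \<mu>1 \<in> States D1 \<and> \<nu>1 \<in> States D1 \<and> agree_on (Val D1) (Vars D1) \<mu>1 \<nu>1}
      | Inr q \<Rightarrow> {((\<mu>0, \<mu>1), (\<nu>0, \<nu>1)). (\<mu>1, \<nu>1) \<in> EvalP D1 q \<and>
                   \<mu>0 \<in> States D0 \<and> \<nu>0 \<in> States D0 \<and> agree_on (Val D0) (Vars D0) \<mu>0 \<nu>0})"

lemma het_evalP_Inl_identity:
  assumes "\<And>\<mu> \<nu>. \<lbrakk>\<mu> \<in> States D1; \<nu> \<in> States D1; agree_on (Val D1) (Vars D1) \<mu> \<nu>\<rbrakk> \<Longrightarrow> \<mu> = \<nu>"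
  shows "het_evalP D0 D1 (Inl p) =
    {((\<mu>0, \<mu>1), (\<nu>0, \<nu>1)). (\<mu>0, \<nu>0) \<in> EvalP D0 p \<and> \<mu>1 \<in> States D1 \<and> \<nu>1 = \<mu>1}"
  using assms by (auto simp: het_evalP_def) (auto simp: agree_on_def)

lemma het_evalP_Inr_identity:
  assumes "\<And>\<mu> \<nu>. \<lbrakk>\<mu> \<in> States D0; \<nu> \<in> States D0; agree_on (Val D0) (Vars D0) \<mu> \<nu>\<rbrakk> \<Longrightarrow> \<mu> = \<nu>"
  shows "het_evalP D0 D1 (Inr q) =
    {((\<mu>0, \<mu>1), (\<nu>0, \<nu>1)). (\<mu>1, \<nu>1) \<in> EvalP D1 q \<and> \<mu>0 \<in> States D0 \<and> \<nu>0 = \<mu>0}"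
  using assms by (auto simp: het_evalP_def) (auto simp: agree_on_def)

definition simple_het_theory ::
  "('v0, 'a0, 'p0, 'u, 's0) dyn_theory \<Rightarrow> ('v1, 'a1, 'p1, 'u, 's1) dyn_theory \<Rightarrow>
     'c set \<Rightarrow> ('c \<Rightarrow> ('s0 \<times> 's1) set) \<Rightarrow> ('c \<Rightarrow> ('v0 + 'v1) set) \<Rightarrow>
     ('v0 + 'v1, 'a0 + 'a1 + 'c, 'p0 + 'p1, 'u, 's0 \<times> 's1) dyn_theory" where
  "simple_het_theory D0 D1 Ac evalAc fvAc =
     \<lparr>Vars = het_vars D0 D1,
      Atoms = Atoms D0 <+> (Atoms D1 <+> Ac),
      Progs = Progs D0 <+> Progs D1,
      Univ = Univ D0 \<union> Univ D1,
      States = het_states D0 D1,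
      Val = het_val D0 D1,
      EvalA = (\<lambda>x. case x of
                 Inl a \<Rightarrow> EvalA D0 a \<times> States D1
               | Inr (Inl b) \<Rightarrow> States D0 \<times> EvalA D1 b
               | Inr (Inr c) \<Rightarrow> evalAc c),
      FVA = (\<lambda>x. case x of
                 Inl a \<Rightarrow> Inl ` FVA D0 a
               | Inr (Inl b) \<Rightarrow> Inr ` FVA D1 b
               | Inr (Inr c) \<Rightarrow> fvAc c),
      EvalP = het_evalP D0 D1,
      FVP = (\<lambda>r. case r of Inl p \<Rightarrow> Inl ` FVP D0 p | Inr q \<Rightarrow> Inr ` FVP D1 q)\<rparr>"

end

theory Submission
  imports Defs
begin

text \<open>
  (G) and (K) hold for any transition semantics. The truth of a formula only depends on finitely many
  variables. Hence two states that differ only outside the semantic free variables can be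
  connected, up to agreement on such a finite set, by finitely many single-variable changes obtained
  by interpolation, none of which affects truth; this gives (V). For (B), interpolation transfers the
  value of \<open>v\<close> between the initial states of two runs, which \<open>\<alpha>\<close> neither reads nor changes.
\<close>

section \<open>Agreement of states, derived connectives, and soundness of (G) and (K)\<close>

lemma agree_on_sym: "agree_on val W \<mu> \<nu> \<Longrightarrow> agree_on val W \<nu> \<mu>"
  by (auto simp: agree_on_def)

lemma agree_on_refl: "agree_on val W \<mu> \<mu>"
  by (simp add: agree_on_def)

lemma agree_on_trans: "\<lbrakk>agree_on val W \<mu> \<nu>; agree_on val W \<nu> \<omega>\<rbrakk> \<Longrightarrow> agree_on val W \<mu> \<omega>"
  by (auto simp: agree_on_def)

lemma agree_on_mono: "\<lbrakk>agree_on val W \<mu> \<nu>; X \<subseteq> W\<rbrakk> \<Longrightarrow> agree_on val X \<mu> \<nu>"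
  by (auto simp: agree_on_def)

lemma agree_on_Un: "agree_on val (X \<union> Y) \<mu> \<nu> \<longleftrightarrow> agree_on val X \<mu> \<nu> \<and> agree_on val Y \<mu> \<nu>"
  by (auto simp: agree_on_def)

lemma agree_on_glue:
  "\<lbrakk>agree_on val X \<mu> \<nu>; agree_on val (W - X) \<mu> \<nu>\<rbrakk> \<Longrightarrow> agree_on val W \<mu> \<nu>"
  unfolding agree_on_def by blast

lemma sem_Imp: "\<mu> \<in> States D \<Longrightarrow> \<mu> \<in> sem D (Imp F G) \<longleftrightarrow> (\<mu> \<in> sem D F \<longrightarrow> \<mu> \<in> sem D G)"
  by (auto simp: Imp_def)

lemma sem_Iff: "\<mu> \<in> States D \<Longrightarrow> \<mu> \<in> sem D (Iff F G) \<longleftrightarrow> (\<mu> \<in> sem D F \<longleftrightarrow> \<mu> \<in> sem D G)"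
  by (auto simp: Iff_def sem_Imp)

lemma valid_Box: "valid D \<phi> \<Longrightarrow> valid D (Box \<alpha> \<phi>)"
  by (simp add: valid_def)

lemma valid_K: "valid D (Imp (Box \<alpha> (Imp \<phi> \<psi>)) (Imp (Box \<alpha> \<phi>) (Box \<alpha> \<psi>)))"
  by (simp add: valid_def sem_Imp)

section \<open>Finite dependence of formulas on variables\<close>

definition depends_only_on ::
  "('v, 'a, 'p, 'u, 's) dyn_theory \<Rightarrow> 'v set \<Rightarrow> ('v, 'a, 'p) fml \<Rightarrow> bool" where
  "depends_only_on D X F \<longleftrightarrow>
     (\<forall>\<mu>\<in>States D. \<forall>\<nu>\<in>States D. agree_on (Val D) X \<mu> \<nu> \<longrightarrow> \<mu> \<in> sem D F \<longrightarrow> \<nu> \<in> sem D F)"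

lemma depends_only_onI:
  assumes "\<And>\<mu> \<nu>. \<lbrakk>\<mu> \<in> States D; \<nu> \<in> States D; agree_on (Val D) X \<mu> \<nu>; \<mu> \<in> sem D F\<rbrakk> \<Longrightarrow> \<nu> \<in> sem D F"
  shows "depends_only_on D X F"
  using assms by (auto simp: depends_only_on_def)

text \<open>Agreement is symmetric, so the single implication in the definition already yields an
  equivalence. Negation and all later transfers of truth rely on this form.\<close>

lemma depends_only_onD:
  assumes "depends_only_on D X F" "\<mu> \<in> States D" "\<nu> \<in> States D" "agree_on (Val D) X \<mu> \<nu>"
  shows "\<mu> \<in> sem D F \<longleftrightarrow> \<nu> \<in> sem D F"
  using assms agree_on_sym[OF assms(4)] unfolding depends_only_on_def by blast

lemma depends_only_on_mono:
  "\<lbrakk>depends_only_on D X F; X \<subseteq> Y\<rbrakk> \<Longrightarrow> depends_only_on D Y F"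
  unfolding depends_only_on_def by (blast intro: agree_on_mono)

context dynamic_theory
begin

text \<open>Every \<open>v\<close>-variant of \<open>\<nu>\<close> can be matched by a
  \<open>v\<close>-variant of \<open>\<mu>\<close> with the same value at \<open>v\<close>. The
  bound variable stays in \<open>X\<close>, since only finiteness of the set matters later.\<close>

lemma depends_only_on_Forall:
  assumes v: "v \<in> Vars D" and X: "X \<subseteq> Vars D" "depends_only_on D X F"
  shows "depends_only_on D X (Forall v F)"
proof (rule depends_only_onI)
  fix \<mu> \<nu> assume \<mu>: "\<mu> \<in> States D" and \<nu>: "\<nu> \<in> States D"
    and eq: "agree_on (Val D) X \<mu> \<nu>" and all: "\<mu> \<in> sem D (Forall v F)"
  have "\<nu>' \<in> sem D F" if \<nu>': "\<nu>' \<in> States D" "agree_on (Val D) (Vars D - {v}) \<nu> \<nu>'" for \<nu>'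
  proof -
    \<comment> \<open>\<open>\<omega>\<close> takes its value at \<open>v\<close> from
      \<open>\<nu>'\<close> and all other values from \<open>\<mu>\<close>. On
      \<open>X - {v}\<close> the chain \<open>\<omega>\<close>, \<open>\<mu>\<close>,
      \<open>\<nu>\<close>, \<open>\<nu>'\<close> then gives agreement.\<close>
    obtain \<omega> where \<omega>: "\<omega> \<in> States D" "agree_on (Val D) (Vars D - {v}) \<omega> \<mu>"
        "agree_on (Val D) {v} \<omega> \<nu>'"
      using interpolation[OF \<nu>'(1) \<mu>, of "{v}"] v by blast
    have "\<omega> \<in> sem D F"
      using all \<omega>(1) agree_on_sym[OF \<omega>(2)] by simp
    moreover have "agree_on (Val D) X \<omega> \<nu>'"
    proof (rule agree_on_glue[OF \<omega>(3)])
      have sub: "X - {v} \<subseteq> Vars D - {v}" "X - {v} \<subseteq> X" using X(1) by auto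
      show "agree_on (Val D) (X - {v}) \<omega> \<nu>'"
        using agree_on_mono[OF \<omega>(2) sub(1)] agree_on_mono[OF eq sub(2)]
          agree_on_mono[OF \<nu>'(2) sub(1)]
        by (blast intro: agree_on_trans)
    qed
    ultimately show ?thesis
      using depends_only_onD[OF X(2) \<omega>(1) \<nu>'(1)] by blast
  qed
  then show "\<nu> \<in> sem D (Forall v F)"
    using \<nu> by simp
qed

text \<open>Overapproximation is applied with the set \<open>FVP D p \<union> X\<close>: it contains
  \<open>FVP D p\<close>, so runs can be simulated, and it contains \<open>X\<close>, so the final
  states agree on what decides \<open>F\<close>.\<close>

lemma depends_only_on_Box:
  assumes p: "p \<in> Progs D" and X: "X \<subseteq> Vars D" "depends_only_on D X F"
  shows "depends_only_on D (FVP D p \<union> X) (Box p F)"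
proof (rule depends_only_onI)
  fix \<mu> \<nu> assume \<mu>: "\<mu> \<in> States D" and \<nu>: "\<nu> \<in> States D"
    and eq: "agree_on (Val D) (FVP D p \<union> X) \<mu> \<nu>" and box: "\<mu> \<in> sem D (Box p F)"
  have "\<omega> \<in> sem D F" if \<omega>: "\<omega> \<in> States D" "(\<nu>, \<omega>) \<in> EvalP D p" for \<omega>
  proof -
    \<comment> \<open>The simulation goes from \<open>\<nu>\<close> back to \<open>\<mu>\<close>,
      because the box is assumed at \<open>\<mu>\<close>.\<close>
    obtain \<omega>' where \<omega>': "\<omega>' \<in> States D" "(\<mu>, \<omega>') \<in> EvalP D p"
        "agree_on (Val D) (FVP D p \<union> X) \<omega> \<omega>'"
      using prog_overapproximation[OF p Un_upper1 _ \<nu> \<mu> \<omega>(1) agree_on_sym[OF eq] \<omega>(2)]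
        FVP_subset[OF p] X(1) by blast
    then have "\<omega>' \<in> sem D F"
      using box by simp
    then show ?thesis
      using depends_only_onD[OF X(2) \<omega>(1) \<omega>'(1)] \<omega>'(3) by (simp add: agree_on_Un)
  qed
  then show "\<nu> \<in> sem D (Box p F)"
    using \<nu> by simp
qed

text \<open>The set collects the \<open>FVA\<close> and \<open>FVP\<close> sets of the atoms and
  programs occurring in \<open>F\<close>. There are finitely many of these and each is
  finite.\<close>

lemma finite_dependence:
  assumes "F \<in> formulas D"
  shows "\<exists>X. finite X \<and> X \<subseteq> Vars D \<and> depends_only_on D X F"
  using assms
proof (induction F rule: formulas.induct)
  case (1 a)
  then have "finite (FVA D a)" "FVA D a \<subseteq> Vars D" "depends_only_on D (FVA D a) (Atom a)"
    using atoms by (auto simp: atom_requirements_def depends_only_on_def)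
  then show ?case by blast
next
  case (2 F)
  then obtain X where X: "finite X" "X \<subseteq> Vars D" "depends_only_on D X F"
    by blast
  then have "depends_only_on D X (Neg F)"
    using depends_only_onD[OF X(3)] by (auto intro!: depends_only_onI)
  then show ?case using X by blast
next
  case (3 F G)
  then obtain X Y where X: "finite X" "X \<subseteq> Vars D" "depends_only_on D X F"
    and Y: "finite Y" "Y \<subseteq> Vars D" "depends_only_on D Y G"
    by blast
  then have "depends_only_on D (X \<union> Y) (Conj F G)"
    using depends_only_onD[OF X(3)] depends_only_onD[OF Y(3)]
    by (auto intro!: depends_only_onI simp: agree_on_Un)
  moreover have "finite (X \<union> Y)" "X \<union> Y \<subseteq> Vars D" using X Y by auto
  ultimately show ?case by blast
next
  case (4 v F)
  then show ?case using depends_only_on_Forall by blast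
next
  case (5 p F)
  then obtain X where X: "finite X" "X \<subseteq> Vars D" "depends_only_on D X F"
    by blast
  have "finite (FVP D p \<union> X)" "FVP D p \<union> X \<subseteq> Vars D"
    using X FVP_finite[OF 5(1)] FVP_subset[OF 5(1)] by auto
  then show ?case using depends_only_on_Box[OF 5(1) X(2,3)] by blast
qed

section \<open>Coincidence on the semantic free variables\<close>

lemma extensionality_fml:
  assumes "F \<in> formulas D"
  shows "depends_only_on D (Vars D) F"
  using finite_dependence[OF assms] depends_only_on_mono by blast

text \<open>\<open>FVsem_fml\<close> only tests changes of a single variable. Induction on the
  finite set \<open>X\<close> composes such changes one at a time.\<close>

lemma finite_change_outside_FVsem:
  assumes F: "F \<in> formulas D" and "finite X" "X \<subseteq> Vars D" "X \<inter> FVsem_fml D F = {}"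
  shows "depends_only_on D (Vars D - X) F"
  using assms(2-)
proof (induction X rule: finite_induct)
  case empty
  then show ?case using extensionality_fml[OF F] by simp
next
  case (insert x X)
  show ?case
  proof (rule depends_only_onI)
    fix \<mu> \<nu> assume \<mu>: "\<mu> \<in> States D" and \<nu>: "\<nu> \<in> States D"
      and eq: "agree_on (Val D) (Vars D - insert x X) \<mu> \<nu>" and true: "\<mu> \<in> sem D F"
    \<comment> \<open>\<open>\<omega>\<close> is \<open>\<mu>\<close> with the value at
      \<open>x\<close> replaced by that of \<open>\<nu>\<close>. Truth survives this one change
      because \<open>x\<close> is not semantically free, and what still differs from
      \<open>\<nu>\<close> lies in \<open>X\<close>.\<close>
    obtain \<omega> where \<omega>: "\<omega> \<in> States D" "agree_on (Val D) {x} \<omega> \<nu>"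
        "agree_on (Val D) (Vars D - {x}) \<omega> \<mu>"
      using interpolation[OF \<nu> \<mu>, of "{x}"] insert.prems(1) by blast
    have "\<omega> \<in> sem D F"
    proof (rule ccontr)
      assume "\<omega> \<notin> sem D F"
      then have "x \<in> FVsem_fml D F"
        using \<mu> \<omega>(1) agree_on_sym[OF \<omega>(3)] true insert.prems(1) unfolding FVsem_fml_def by blast
      then show False using insert.prems(2) by blast
    qed
    moreover have "agree_on (Val D) (Vars D - X) \<omega> \<nu>"
    proof (rule agree_on_glue[OF \<omega>(2)])
      have "Vars D - X - {x} = Vars D - insert x X" by auto
      then show "agree_on (Val D) (Vars D - X - {x}) \<omega> \<nu>"
        using agree_on_mono[OF \<omega>(3), of "Vars D - insert x X"] eq
        by (auto intro: agree_on_trans)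
    qed
    ultimately show "\<nu> \<in> sem D F"
      using depends_only_onD[OF insert.IH \<omega>(1) \<nu>] insert.prems by auto
  qed
qed

text \<open>\<open>\<mu>\<close> and \<open>\<nu>\<close> may differ at infinitely many variables,
  so the finite version cannot be applied to them directly. Finite dependence leaves only finitely
  many relevant variables to change.\<close>

lemma depends_only_on_FVsem:
  assumes F: "F \<in> formulas D"
  shows "depends_only_on D (FVsem_fml D F) F"
proof (rule depends_only_onI)
  fix \<mu> \<nu> assume \<mu>: "\<mu> \<in> States D" and \<nu>: "\<nu> \<in> States D"
    and eq: "agree_on (Val D) (FVsem_fml D F) \<mu> \<nu>" and true: "\<mu> \<in> sem D F"
  obtain X where X: "finite X" "X \<subseteq> Vars D" "depends_only_on D X F"
    using finite_dependence[OF F] by blast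
  \<comment> \<open>\<open>Y\<close> holds the relevant variables at which \<open>\<mu>\<close> and
    \<open>\<nu>\<close> may still differ.\<close>
  define Y where "Y = X - FVsem_fml D F"
  have Y: "finite Y" "Y \<subseteq> Vars D" "Y \<inter> FVsem_fml D F = {}"
    using X by (auto simp: Y_def)
  obtain \<omega> where \<omega>: "\<omega> \<in> States D" "agree_on (Val D) Y \<omega> \<nu>"
      "agree_on (Val D) (Vars D - Y) \<omega> \<mu>"
    using interpolation[OF \<nu> \<mu> Y(2)] by blast
  have "\<omega> \<in> sem D F"
    using depends_only_onD[OF finite_change_outside_FVsem[OF F Y] \<omega>(1) \<mu> \<omega>(3)] true by blast
  \<comment> \<open>On \<open>Y\<close> the values of \<open>\<omega>\<close> come from
    \<open>\<nu>\<close>. The rest of \<open>X\<close> is semantically free, where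
    \<open>\<omega>\<close> agrees with \<open>\<mu>\<close> and hence with
    \<open>\<nu>\<close>.\<close>
  moreover have "agree_on (Val D) X \<omega> \<nu>"
    using eq \<omega>(2,3) X(2) by (fastforce simp: agree_on_def Y_def)
  ultimately show "\<nu> \<in> sem D F"
    using depends_only_onD[OF X(3) \<omega>(1) \<nu>] by blast
qed

section \<open>Soundness of (V) and (B) in an arbitrary dynamic theory\<close>

lemma valid_V:
  assumes F: "F \<in> formulas D" and disj: "FVsem_fml D F \<inter> BVsem_prog D p = {}"
  shows "valid D (Imp F (Box p F))"
proof -
  have "\<nu> \<in> sem D F"
    if "\<mu> \<in> States D" "\<mu> \<in> sem D F" "\<nu> \<in> States D" "(\<mu>, \<nu>) \<in> EvalP D p" for \<mu> \<nu>
  proof -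
    have "FVsem_fml D F \<subseteq> Vars D" by (auto simp: FVsem_fml_def)
    \<comment> \<open>A run changes only variables in \<open>BVsem_prog D p\<close>, and none of
      these is semantically free in \<open>F\<close>.\<close>
    then have "agree_on (Val D) (FVsem_fml D F) \<mu> \<nu>"
      using disj that unfolding agree_on_def BVsem_prog_def by blast
    then show ?thesis
      using depends_only_onD[OF depends_only_on_FVsem[OF F]] that by blast
  qed
  then show ?thesis by (simp add: valid_def sem_Imp)
qed

lemma valid_B:
  assumes F: "F \<in> formulas D" and v: "v \<in> Vars D"
    and FV: "v \<notin> FVsem_prog D p" and BV: "v \<notin> BVsem_prog D p"
  shows "valid D (Iff (Forall v (Box p F)) (Box p (Forall v F)))"
proof -
  let ?eq = "agree_on (Val D) (Vars D - {v})"
  \<comment> \<open>This is \<open>v \<notin> FVsem_prog D p\<close> read positively: runs can be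
    moved between \<open>v\<close>-variants of the initial state, up to \<open>v\<close> in the
    final state.\<close>
  have transfer: "\<exists>\<nu>'\<in>States D. ?eq \<nu> \<nu>' \<and> (\<mu>', \<nu>') \<in> EvalP D p"
    if "\<mu> \<in> States D" "\<mu>' \<in> States D" "\<nu> \<in> States D" "?eq \<mu> \<mu>'" "(\<mu>, \<nu>) \<in> EvalP D p" for \<mu> \<mu>' \<nu>
    using FV v that unfolding FVsem_prog_def by blast
  have "\<mu> \<in> sem D (Forall v (Box p F)) \<longleftrightarrow> \<mu> \<in> sem D (Box p (Forall v F))"
    if \<mu>: "\<mu> \<in> States D" for \<mu>
  proof
    assume all: "\<mu> \<in> sem D (Forall v (Box p F))"
    have "\<nu>' \<in> sem D F"
      if \<nu>: "\<nu> \<in> States D" "(\<mu>, \<nu>) \<in> EvalP D p" and \<nu>': "\<nu>' \<in> States D" "?eq \<nu> \<nu>'" for \<nu> \<nu>'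
    proof -
      obtain \<mu>' where \<mu>': "\<mu>' \<in> States D" "agree_on (Val D) {v} \<mu>' \<nu>'" "?eq \<mu>' \<mu>"
        using interpolation[OF \<nu>'(1) \<mu>, of "{v}"] v by blast
      obtain \<omega> where \<omega>: "\<omega> \<in> States D" "?eq \<nu> \<omega>" "(\<mu>', \<omega>) \<in> EvalP D p"
        using transfer[OF \<mu> \<mu>'(1) \<nu>(1) agree_on_sym[OF \<mu>'(3)] \<nu>(2)] by blast
      have "Val D \<mu>' v = Val D \<omega> v"
        using BV v \<mu>'(1) \<omega>(1,3) unfolding BVsem_prog_def by blast
      then have "agree_on (Val D) {v} \<omega> \<nu>'"
        using \<mu>'(2) by (simp add: agree_on_def)
      moreover have "?eq \<omega> \<nu>'"
        by (rule agree_on_trans[OF agree_on_sym[OF \<omega>(2)] \<nu>'(2)])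
      \<comment> \<open>The two states need not be equal, but agreement on all variables suffices by
        extensionality of formulas.\<close>
      ultimately have "agree_on (Val D) (Vars D) \<omega> \<nu>'"
        by (rule agree_on_glue)
      moreover have "\<omega> \<in> sem D F"
        using all \<mu>'(1) agree_on_sym[OF \<mu>'(3)] \<omega>(1,3) by simp
      ultimately show ?thesis
        using depends_only_onD[OF extensionality_fml[OF F] \<omega>(1) \<nu>'(1)] by blast
    qed
    then show "\<mu> \<in> sem D (Box p (Forall v F))"
      using \<mu> by simp
  next
    assume box: "\<mu> \<in> sem D (Box p (Forall v F))"
    have "\<nu>' \<in> sem D F"
      if \<mu>': "\<mu>' \<in> States D" "?eq \<mu> \<mu>'" and \<nu>': "\<nu>' \<in> States D" "(\<mu>', \<nu>') \<in> EvalP D p" for \<mu>' \<nu>'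
    proof -
      \<comment> \<open>Moving the run from \<open>\<mu>'\<close> back to \<open>\<mu>\<close> ends
        in a \<open>v\<close>-variant \<open>\<nu>\<close> of \<open>\<nu>'\<close>. The box at
        \<open>\<mu>\<close> gives \<open>Forall v F\<close> at \<open>\<nu>\<close>, hence
        \<open>F\<close> at \<open>\<nu>'\<close>.\<close>
      obtain \<nu> where \<nu>: "\<nu> \<in> States D" "?eq \<nu>' \<nu>" "(\<mu>, \<nu>) \<in> EvalP D p"
        using transfer[OF \<mu>'(1) \<mu> \<nu>'(1) agree_on_sym[OF \<mu>'(2)] \<nu>'(2)] by blast
      then show ?thesis
        using box \<nu>'(1) agree_on_sym[OF \<nu>(2)] by simp
    qed
    then show "\<mu> \<in> sem D (Forall v (Box p F))"
      using \<mu> by simp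
  qed
  then show ?thesis by (simp add: valid_def sem_Iff)
qed

end

section \<open>Agreement and transitions in the product state space\<close>

lemma agree_on_het:
  "agree_on (het_val D0 D1) W (\<mu>0, \<mu>1) (\<nu>0, \<nu>1) \<longleftrightarrow>
     agree_on (Val D0) (Inl -` W) \<mu>0 \<nu>0 \<and> agree_on (Val D1) (Inr -` W) \<mu>1 \<nu>1"
proof
  assume "agree_on (Val D0) (Inl -` W) \<mu>0 \<nu>0 \<and> agree_on (Val D1) (Inr -` W) \<mu>1 \<nu>1"
  then show "agree_on (het_val D0 D1) W (\<mu>0, \<mu>1) (\<nu>0, \<nu>1)"
    by (auto simp: agree_on_def het_val_def split: sum.split)
qed (force simp: agree_on_def het_val_def)

lemma vimage_het_vars:
  "Inl -` het_vars D0 D1 = Vars D0" "Inr -` het_vars D0 D1 = Vars D1"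
  by (auto simp: het_vars_def)

lemma vimage_image_disjoint: "Inl -` (Inr ` X) = {}" "Inr -` (Inl ` X) = {}"
  by auto

lemma simple_het_theory_sel:
  "Vars (simple_het_theory D0 D1 Ac evalAc fvAc) = het_vars D0 D1"
  "Progs (simple_het_theory D0 D1 Ac evalAc fvAc) = Progs D0 <+> Progs D1"
  "Univ (simple_het_theory D0 D1 Ac evalAc fvAc) = Univ D0 \<union> Univ D1"
  "States (simple_het_theory D0 D1 Ac evalAc fvAc) = States D0 \<times> States D1"
  "Val (simple_het_theory D0 D1 Ac evalAc fvAc) = het_val D0 D1"
  "EvalP (simple_het_theory D0 D1 Ac evalAc fvAc) = het_evalP D0 D1"
  "FVP (simple_het_theory D0 D1 Ac evalAc fvAc) (Inl p) = Inl ` FVP D0 p"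
  "FVP (simple_het_theory D0 D1 Ac evalAc fvAc) (Inr q) = Inr ` FVP D1 q"
  by (simp_all add: simple_het_theory_def het_states_def)

lemma het_evalP_Inl:
  "((\<mu>0, \<mu>1), (\<nu>0, \<nu>1)) \<in> het_evalP D0 D1 (Inl p) \<longleftrightarrow>
     (\<mu>0, \<nu>0) \<in> EvalP D0 p \<and> \<mu>1 \<in> States D1 \<and> \<nu>1 \<in> States D1 \<and> agree_on (Val D1) (Vars D1) \<mu>1 \<nu>1"
  by (simp add: het_evalP_def)

lemma het_evalP_Inr:
  "((\<mu>0, \<mu>1), (\<nu>0, \<nu>1)) \<in> het_evalP D0 D1 (Inr q) \<longleftrightarrow>
     (\<mu>1, \<nu>1) \<in> EvalP D1 q \<and> \<mu>0 \<in> States D0 \<and> \<nu>0 \<in> States D0 \<and> agree_on (Val D0) (Vars D0) \<mu>0 \<nu>0"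
  by (simp add: het_evalP_def)

section \<open>The simple heterogeneous theory is a dynamic theory\<close>

lemma simple_het_theory_atoms:
  assumes D0: "dynamic_theory D0" and D1: "dynamic_theory D1"
    and Ac: "heterogeneous_atoms D0 D1 Ac evalAc fvAc"
  defines "D \<equiv> simple_het_theory D0 D1 Ac evalAc fvAc"
  shows "atom_requirements (Vars D) (States D) (Val D) (Atoms D) (EvalA D) (FVA D)"
proof -
  have at: "EvalA D a \<subseteq> States D \<and> FVA D a \<subseteq> Vars D \<and> finite (FVA D a) \<and>
      (\<forall>\<mu>\<in>States D. \<forall>\<nu>\<in>States D. agree_on (Val D) (FVA D a) \<mu> \<nu> \<longrightarrow>
        (\<mu> \<in> EvalA D a \<longleftrightarrow> \<nu> \<in> EvalA D a))" if "a \<in> Atoms D" for a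
  proof -
    consider (l) a0 where "a = Inl a0" "a0 \<in> Atoms D0" | (r) a1 where "a = Inr (Inl a1)" "a1 \<in> Atoms D1"
      | (c) c where "a = Inr (Inr c)" "c \<in> Ac"
      using \<open>a \<in> Atoms D\<close> by (auto simp: D_def simple_het_theory_def)
    then show ?thesis
    proof cases
      case l
      then show ?thesis
        \<comment> \<open>The free variables of such an atom have empty preimage under
          \<open>Inr\<close>, so agreement in the second component is vacuous and the condition
          reduces to the one in \<open>D0\<close>.\<close>
        using dynamic_theory.atoms[OF D0]
        by (auto simp: D_def simple_het_theory_def het_states_def het_vars_def atom_requirements_def
            agree_on_het inj_vimage_image_eq vimage_image_disjoint)
    next
      case r
      then show ?thesis
        using dynamic_theory.atoms[OF D1]
        by (auto simp: D_def simple_het_theory_def het_states_def het_vars_def atom_requirements_def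
            agree_on_het inj_vimage_image_eq vimage_image_disjoint)
    next
      case c
      then show ?thesis
        using Ac
        by (auto simp: D_def simple_het_theory_def heterogeneous_atoms_def atom_requirements_def)
    qed
  qed
  then show ?thesis by (simp add: atom_requirements_def)
qed

text \<open>Each requirement splits into the two components. For a program, the component it acts on
  inherits the property from its own theory, and the passive one is handled by agreement
  alone.\<close>

lemma dynamic_theory_simple_het:
  assumes D0: "dynamic_theory D0" and D1: "dynamic_theory D1"
    and Ac: "heterogeneous_atoms D0 D1 Ac evalAc fvAc"
  shows "dynamic_theory (simple_het_theory D0 D1 Ac evalAc fvAc)" (is "dynamic_theory ?D")
proof -
  interpret D0: dynamic_theory D0 by (fact D0)
  interpret D1: dynamic_theory D1 by (fact D1)
  note sel = simple_het_theory_sel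
  show ?thesis
  proof
    show "Univ ?D \<noteq> {}" "States ?D \<noteq> {}"
      using D0.univ_nonempty D0.states_nonempty D1.states_nonempty by (auto simp: sel)
    show "Val ?D \<mu> v \<in> Univ ?D" if "\<mu> \<in> States ?D" "v \<in> Vars ?D" for \<mu> v
      using that D0.val_in_univ D1.val_in_univ by (auto simp: sel het_val_def het_vars_def)
    show "\<exists>\<omega>\<in>States ?D. agree_on (Val ?D) W \<omega> \<mu> \<and> agree_on (Val ?D) (Vars ?D - W) \<omega> \<nu>"
      if \<mu>\<nu>: "\<mu> \<in> States ?D" "\<nu> \<in> States ?D" and W_sub: "W \<subseteq> Vars ?D" for \<mu> \<nu> W
    proof -
      obtain \<mu>0 \<mu>1 \<nu>0 \<nu>1 where st: "\<mu> = (\<mu>0, \<mu>1)" "\<nu> = (\<nu>0, \<nu>1)" "\<mu>0 \<in> States D0" "\<mu>1 \<in> States D1"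
          "\<nu>0 \<in> States D0" "\<nu>1 \<in> States D1"
        using \<mu>\<nu> by (auto simp: sel)
      have W: "Inl -` W \<subseteq> Vars D0" "Inr -` W \<subseteq> Vars D1"
        using W_sub by (auto simp: sel het_vars_def)
      obtain \<omega>0 where \<omega>0: "\<omega>0 \<in> States D0" "agree_on (Val D0) (Inl -` W) \<omega>0 \<mu>0"
          "agree_on (Val D0) (Vars D0 - Inl -` W) \<omega>0 \<nu>0"
        using D0.interpolation[OF st(3,5) W(1)] by blast
      obtain \<omega>1 where \<omega>1: "\<omega>1 \<in> States D1" "agree_on (Val D1) (Inr -` W) \<omega>1 \<mu>1"
          "agree_on (Val D1) (Vars D1 - Inr -` W) \<omega>1 \<nu>1"
        using D1.interpolation[OF st(4,6) W(2)] by blast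
      show ?thesis
        using \<omega>0 \<omega>1 st(1,2)
        by (intro bexI[of _ "(\<omega>0, \<omega>1)"]) (auto simp: sel agree_on_het vimage_Diff vimage_het_vars)
    qed
    show "atom_requirements (Vars ?D) (States ?D) (Val ?D) (Atoms ?D) (EvalA ?D) (FVA ?D)"
      by (rule simple_het_theory_atoms[OF D0 D1 Ac])
    show "EvalP ?D p \<subseteq> States ?D \<times> States ?D" if "p \<in> Progs ?D" for p
      using that D0.evalP_subset D1.evalP_subset by (force simp: sel het_evalP_Inl het_evalP_Inr)
    show "FVP ?D p \<subseteq> Vars ?D" if "p \<in> Progs ?D" for p
      using that D0.FVP_subset D1.FVP_subset by (fastforce simp: sel het_vars_def)
    show "finite (FVP ?D p)" if "p \<in> Progs ?D" for p
      using that D0.FVP_finite D1.FVP_finite by (auto simp: sel)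
    show "\<exists>\<omega>'\<in>States ?D. (\<nu>, \<omega>') \<in> EvalP ?D p \<and> agree_on (Val ?D) W \<omega> \<omega>'"
      if p: "p \<in> Progs ?D" and W: "FVP ?D p \<subseteq> W" "W \<subseteq> Vars ?D"
        and st: "\<mu> \<in> States ?D" "\<nu> \<in> States ?D" "\<omega> \<in> States ?D"
        and eq: "agree_on (Val ?D) W \<mu> \<nu>" and run: "(\<mu>, \<omega>) \<in> EvalP ?D p" for p W \<mu> \<nu> \<omega>
    proof -
      obtain \<mu>0 \<mu>1 \<nu>0 \<nu>1 \<omega>0 \<omega>1 where pairs: "\<mu> = (\<mu>0, \<mu>1)" "\<nu> = (\<nu>0, \<nu>1)" "\<omega> = (\<omega>0, \<omega>1)"
        by (metis surj_pair)
      have st': "\<mu>0 \<in> States D0" "\<nu>0 \<in> States D0" "\<omega>0 \<in> States D0"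
        "\<mu>1 \<in> States D1" "\<nu>1 \<in> States D1" "\<omega>1 \<in> States D1"
        using st by (auto simp: sel pairs)
      have eq': "agree_on (Val D0) (Inl -` W) \<mu>0 \<nu>0" "agree_on (Val D1) (Inr -` W) \<mu>1 \<nu>1"
        using eq by (auto simp: sel pairs agree_on_het)
      have W': "Inl -` W \<subseteq> Vars D0" "Inr -` W \<subseteq> Vars D1"
        using W(2) by (auto simp: sel het_vars_def)
      show ?thesis
      proof (cases p)
        case (Inl p0)
        have "p0 \<in> Progs D0" "FVP D0 p0 \<subseteq> Inl -` W"
          using p W(1) by (auto simp: sel Inl)
        moreover have run': "(\<mu>0, \<omega>0) \<in> EvalP D0 p0" "agree_on (Val D1) (Vars D1) \<mu>1 \<omega>1"
          using run by (auto simp: sel pairs Inl het_evalP_Inl)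
        ultimately obtain \<omega>0' where "\<omega>0' \<in> States D0" "(\<nu>0, \<omega>0') \<in> EvalP D0 p0"
            "agree_on (Val D0) (Inl -` W) \<omega>0 \<omega>0'"
          using D0.prog_overapproximation[OF _ _ W'(1) st'(1,2,3) eq'(1)] by blast
        \<comment> \<open>The simulating run leaves the passive component at \<open>\<nu>1\<close>
          itself. The given run kept \<open>\<mu>1\<close> up to agreement, and
          \<open>\<mu>1\<close> agrees with \<open>\<nu>1\<close> on \<open>Inr -\<close> followed
          by \<open>W\<close>, so the final states match there.\<close>
        moreover have "agree_on (Val D1) (Inr -` W) \<omega>1 \<nu>1"
          using agree_on_mono[OF run'(2) W'(2)] eq'(2) by (simp add: agree_on_def)
        ultimately show ?thesis
          using st'(5)
          by (intro bexI[of _ "(\<omega>0', \<nu>1)"])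
            (simp_all add: sel pairs Inl het_evalP_Inl agree_on_het agree_on_refl)
      next
        case (Inr p1)
        have "p1 \<in> Progs D1" "FVP D1 p1 \<subseteq> Inr -` W"
          using p W(1) by (auto simp: sel Inr)
        moreover have run': "(\<mu>1, \<omega>1) \<in> EvalP D1 p1" "agree_on (Val D0) (Vars D0) \<mu>0 \<omega>0"
          using run by (auto simp: sel pairs Inr het_evalP_Inr)
        ultimately obtain \<omega>1' where "\<omega>1' \<in> States D1" "(\<nu>1, \<omega>1') \<in> EvalP D1 p1"
            "agree_on (Val D1) (Inr -` W) \<omega>1 \<omega>1'"
          using D1.prog_overapproximation[OF _ _ W'(2) st'(4,5,6) eq'(2)] by blast
        moreover have "agree_on (Val D0) (Inl -` W) \<omega>0 \<nu>0"
          using agree_on_mono[OF run'(2) W'(1)] eq'(1) by (simp add: agree_on_def)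
        ultimately show ?thesis
          using st'(2)
          by (intro bexI[of _ "(\<nu>0, \<omega>1')"])
            (simp_all add: sel pairs Inr het_evalP_Inr agree_on_het agree_on_refl)
      qed
    qed
    show "(\<mu>, \<omega>) \<in> EvalP ?D p \<longleftrightarrow> (\<nu>, \<omega>) \<in> EvalP ?D p"
      if p: "p \<in> Progs ?D" and st: "\<mu> \<in> States ?D" "\<nu> \<in> States ?D" "\<omega> \<in> States ?D"
        and eq: "agree_on (Val ?D) (Vars ?D) \<mu> \<nu>" for p \<mu> \<nu> \<omega>
    proof -
      obtain \<mu>0 \<mu>1 \<nu>0 \<nu>1 \<omega>0 \<omega>1 where pairs: "\<mu> = (\<mu>0, \<mu>1)" "\<nu> = (\<nu>0, \<nu>1)" "\<omega> = (\<omega>0, \<omega>1)"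
        by (metis surj_pair)
      have st': "\<mu>0 \<in> States D0" "\<nu>0 \<in> States D0" "\<omega>0 \<in> States D0"
        "\<mu>1 \<in> States D1" "\<nu>1 \<in> States D1" "\<omega>1 \<in> States D1"
        using st by (auto simp: sel pairs)
      have eq': "agree_on (Val D0) (Vars D0) \<mu>0 \<nu>0" "agree_on (Val D1) (Vars D1) \<mu>1 \<nu>1"
        using eq by (auto simp: sel pairs agree_on_het vimage_het_vars)
      \<comment> \<open>Passive components are constrained only through their values, so replacing
        the initial state by an agreeing one does not affect the constraint.\<close>
      have eq_iff: "agree_on (Val D0) (Vars D0) \<mu>0 \<omega>0 \<longleftrightarrow> agree_on (Val D0) (Vars D0) \<nu>0 \<omega>0"
        "agree_on (Val D1) (Vars D1) \<mu>1 \<omega>1 \<longleftrightarrow> agree_on (Val D1) (Vars D1) \<nu>1 \<omega>1"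
        using eq' by (simp_all add: agree_on_def)
      show ?thesis
      proof (cases p)
        case (Inl p0)
        then have "p0 \<in> Progs D0" using p by (auto simp: sel)
        then show ?thesis
          using D0.prog_extensionality[OF _ st'(1,2,3) eq'(1)] st' eq_iff(2)
          by (simp add: sel pairs Inl het_evalP_Inl)
      next
        case (Inr p1)
        then have "p1 \<in> Progs D1" using p by (auto simp: sel)
        then show ?thesis
          using D1.prog_extensionality[OF _ st'(4,5,6) eq'(2)] st' eq_iff(1)
          by (simp add: sel pairs Inr het_evalP_Inr)
      qed
    qed
  qed
qed

theorem mainTheorem12:
  fixes D0 :: "('v0, 'a0, 'p0, 'u, 's0) dyn_theory"
    and D1 :: "('v1, 'a1, 'p1, 'u, 's1) dyn_theory"
    and Ac :: "'c set"
    and evalAc :: "'c \<Rightarrow> ('s0 \<times> 's1) set"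
    and fvAc :: "'c \<Rightarrow> ('v0 + 'v1) set"
    and Dsh :: "('v0 + 'v1, 'a0 + 'a1 + 'c, 'p0 + 'p1, 'u, 's0 \<times> 's1) dyn_theory"
  assumes "dynamic_theory D0"
    and "dynamic_theory D1"
    and "heterogeneous_atoms D0 D1 Ac evalAc fvAc"
    and "Dsh = simple_het_theory D0 D1 Ac evalAc fvAc"
  shows "dynamic_theory Dsh \<and>
    (\<forall>\<phi>\<in>formulas Dsh. \<forall>\<alpha>\<in>Progs Dsh. valid Dsh \<phi> \<longrightarrow> valid Dsh (Box \<alpha> \<phi>)) \<and>
    (\<forall>\<phi>\<in>formulas Dsh. \<forall>\<psi>\<in>formulas Dsh. \<forall>\<alpha>\<in>Progs Dsh.
       valid Dsh (Imp (Box \<alpha> (Imp \<phi> \<psi>)) (Imp (Box \<alpha> \<phi>) (Box \<alpha> \<psi>)))) \<and>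
    (\<forall>\<phi>\<in>formulas Dsh. \<forall>\<alpha>\<in>Progs Dsh.
       FVsem_fml Dsh \<phi> \<inter> BVsem_prog Dsh \<alpha> = {} \<longrightarrow> valid Dsh (Imp \<phi> (Box \<alpha> \<phi>))) \<and>
    (\<forall>\<phi>\<in>formulas Dsh. \<forall>\<alpha>\<in>Progs Dsh. \<forall>v\<in>Vars Dsh.
       v \<notin> FVsem_prog Dsh \<alpha> \<union> BVsem_prog Dsh \<alpha> \<longrightarrow>
       valid Dsh (Iff (Forall v (Box \<alpha> \<phi>)) (Box \<alpha> (Forall v \<phi>))))"
proof -
  \<comment> \<open>Once \<open>Dsh\<close> is known to be a dynamic theory, the general results on
    (V) and (B) apply to it.\<close>
  interpret dynamic_theory Dsh
    unfolding assms(4) by (rule dynamic_theory_simple_het[OF assms(1-3)])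
  show ?thesis
    by (simp add: dynamic_theory_axioms valid_Box valid_K valid_V valid_B)
qed

end
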